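(* Let $H_1,H_2\in\mathbb{H}^{n\times n}$ be invertible Hermitian quaternion matrices defining inner products $[x,y]_1=y^*H_1x$ and $[x,y]_2=y^*H_2x$ on $\mathbb{H}^n$, and assume $\pi(H_1)=\pi(H_2)$. Let $V_1,V_2$ be subspaces of $\mathbb{H}^n$ and let $U_0:V_1\to V_2$ be a nonsingular linear transformation such that $[U_0x,U_0y]_2=[x,y]_1$ for all $x,y\in V_1$. Then there exists a linear transformation $U:\mathbb{H}^n\to\mathbb{H}^n$ such that $[Ux,Uy]_2=[x,y]_1$ for all $x,y\in\mathbb{H}^n$ and $Ux=U_0x$ for all $x\in V_1$.
   Context: $\mathbb{H}$ denotes the real quaternions; $\mathbb{H}^n$ is a right vector space over $\mathbb{H}$, and $A^*$ denotes the conjugate transpose of a quaternion matrix. Eigenvalues of a quaternion Hermitian matrix are real; $\pi(H)$ denotes the number of positive eigenvalues (counted with multiplicity) of the Hermitian matrix $H$. *)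

theory Defs
  imports "HOL-Analysis.Analysis"
begin

codatatype quat = Quat (qRe: real) (qI: real) (qJ: real) (qK: real)

lemma quat_eqI [intro?]:
  "qRe x = qRe y \<Longrightarrow> qI x = qI y \<Longrightarrow> qJ x = qJ y \<Longrightarrow> qK x = qK y \<Longrightarrow> x = y"
  by (rule quat.expand) simp

lemma quat_eq_iff: "x = y \<longleftrightarrow> qRe x = qRe y \<and> qI x = qI y \<and> qJ x = qJ y \<and> qK x = qK y"
  by (auto intro: quat_eqI)

instantiation quat :: ring_1
begin

primcorec zero_quat where
  "qRe 0 = 0" | "qI 0 = 0" | "qJ 0 = 0" | "qK 0 = 0"

primcorec one_quat where
  "qRe 1 = 1" | "qI 1 = 0" | "qJ 1 = 0" | "qK 1 = 0"

primcorec plus_quat where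
  "qRe (x + y) = qRe x + qRe y" | "qI (x + y) = qI x + qI y"
| "qJ (x + y) = qJ x + qJ y" | "qK (x + y) = qK x + qK y"

primcorec uminus_quat where
  "qRe (- x) = - qRe x" | "qI (- x) = - qI x" | "qJ (- x) = - qJ x" | "qK (- x) = - qK x"

primcorec minus_quat where
  "qRe (x - y) = qRe x - qRe y" | "qI (x - y) = qI x - qI y"
| "qJ (x - y) = qJ x - qJ y" | "qK (x - y) = qK x - qK y"

primcorec times_quat where
  "qRe (x * y) = qRe x * qRe y - qI x * qI y - qJ x * qJ y - qK x * qK y"
| "qI (x * y) = qRe x * qI y + qI x * qRe y + qJ x * qK y - qK x * qJ y"
| "qJ (x * y) = qRe x * qJ y - qI x * qK y + qJ x * qRe y + qK x * qI y"
| "qK (x * y) = qRe x * qK y + qI x * qJ y - qJ x * qI y + qK x * qRe y"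

instance
  by standard (auto simp: quat_eq_iff algebra_simps)

end

primcorec qcnj :: "quat \<Rightarrow> quat" where
  "qRe (qcnj x) = qRe x" | "qI (qcnj x) = - qI x" | "qJ (qcnj x) = - qJ x" | "qK (qcnj x) = - qK x"

primcorec qreal :: "real \<Rightarrow> quat" where
  "qRe (qreal r) = r" | "qI (qreal r) = 0" | "qJ (qreal r) = 0" | "qK (qreal r) = 0"

definition rscale :: "quat ^ 'n \<Rightarrow> quat \<Rightarrow> quat ^ 'n" (infixl "*r" 70) where
  "x *r c = (\<chi> i. x $ i * c)"

definition qadjoint :: "quat ^ 'n ^ 'm \<Rightarrow> quat ^ 'm ^ 'n" where
  "qadjoint A = (\<chi> i j. qcnj (A $ j $ i))"

definition qhermitian :: "quat ^ 'n ^ 'n \<Rightarrow> bool" where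
  "qhermitian H \<longleftrightarrow> qadjoint H = H"

definition qinvertible :: "quat ^ 'n ^ 'n \<Rightarrow> bool" where
  "qinvertible A \<longleftrightarrow> (\<exists>B. A ** B = mat 1 \<and> B ** A = mat 1)"

definition qform :: "quat ^ 'n ^ 'n \<Rightarrow> quat ^ 'n \<Rightarrow> quat ^ 'n \<Rightarrow> quat" where
  "qform H x y = (\<Sum>i\<in>UNIV. qcnj (y $ i) * (H *v x) $ i)"

definition rsubspace :: "(quat ^ 'n) set \<Rightarrow> bool" where
  "rsubspace V \<longleftrightarrow> 0 \<in> V \<and> (\<forall>x\<in>V. \<forall>y\<in>V. x + y \<in> V) \<and> (\<forall>x\<in>V. \<forall>c. x *r c \<in> V)"

definition rlinear_on :: "(quat ^ 'n) set \<Rightarrow> (quat ^ 'n \<Rightarrow> quat ^ 'm) \<Rightarrow> bool" where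
  "rlinear_on V f \<longleftrightarrow> (\<forall>x\<in>V. \<forall>y\<in>V. f (x + y) = f x + f y) \<and> (\<forall>x\<in>V. \<forall>c. f (x *r c) = f x *r c)"

definition rindep :: "(quat ^ 'n) list \<Rightarrow> bool" where
  "rindep vs \<longleftrightarrow> (\<forall>cs. length cs = length vs \<longrightarrow>
      (\<Sum>k<length vs. vs ! k *r cs ! k) = 0 \<longrightarrow> (\<forall>k<length vs. cs ! k = 0))"

definition qdim :: "(quat ^ 'n) set \<Rightarrow> nat" where
  "qdim S = Max {length vs | vs. set vs \<subseteq> S \<and> rindep vs}"

definition qeigenspace :: "quat ^ 'n ^ 'n \<Rightarrow> real \<Rightarrow> (quat ^ 'n) set" where
  "qeigenspace H l = {x. H *v x = x *r qreal l}"

definition is_real_eigenvalue :: "quat ^ 'n ^ 'n \<Rightarrow> real \<Rightarrow> bool" where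
  "is_real_eigenvalue H l \<longleftrightarrow> (\<exists>x. x \<noteq> 0 \<and> H *v x = x *r qreal l)"

text \<open>pi(H): number of positive eigenvalues counted with multiplicity
  (multiplicity = dimension of the eigenspace, which for Hermitian H equals the algebraic one).\<close>

definition pos_inertia :: "quat ^ 'n ^ 'n \<Rightarrow> nat" where
  "pos_inertia H = (\<Sum>l\<in>{l. l > 0 \<and> is_real_eigenvalue H l}. qdim (qeigenspace H l))"

end

theory Submission
  imports Defs
begin

text \<open>
  A partial isometry with domain \<open>V \<noteq> UNIV\<close> can always be enlarged by one pair \<open>(v, w)\<close>. If \<open>V\<close> is
  degenerate, take \<open>v\<close> not orthogonal to some \<open>r \<noteq> 0\<close> in the radical, represent \<open>[v, _]\<^sub>1\<close> on the range
  by some \<open>w\<close> and correct \<open>[w, w]\<^sub>2\<close> by a multiple of the image of \<open>r\<close>. If \<open>V\<close> is nondegenerate, take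
  \<open>v\<close> and \<open>w\<close> orthogonal to domain and range with \<open>[v, v]\<^sub>1 = [w, w]\<^sub>2 \<noteq> 0\<close>; they exist unless the two
  complements are definite of opposite signs, which would make the inertias differ.

  Inertia is handled over the reals: \<open>H\<close> is a symmetric operator for the real inner product
  \<open>Re (y\<^sup>* x)\<close>, and \<open>4 * pos_inertia H\<close> is the largest dimension of a real subspace on which its
  quadratic form is positive definite, by maximising the Rayleigh quotient.
\<close>

section \<open>Symmetric operators on Euclidean spaces\<close>

text \<open>For small positive \<open>t\<close> the linear term dominates. In
  \<open>max_eigenvector\<close> this is the first-order condition at a maximiser, with
  \<open>b\<close> the squared norm of a residual.\<close>

lemma quadratic_nonpos_imp_zero:
  fixes b c :: real
  assumes le: "\<And>t. 2 * t * b + t\<^sup>2 * c \<le> 0" and "b \<ge> 0"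
  shows "b = 0"
proof (rule ccontr)
  assume "b \<noteq> 0"
  with \<open>b \<ge> 0\<close> have b: "b > 0" by simp
  \<comment> \<open>With \<open>t = b / d\<close> the factor \<open>2 + c / d\<close> is at least 1;
    the summand 1 keeps \<open>d\<close> positive when \<open>c = 0\<close>.\<close>
  define d where "d = \<bar>c\<bar> + 1"
  have d: "d > 0" "\<bar>c\<bar> \<le> d" by (auto simp: d_def)
  have "2 * (b / d) * b + (b / d)\<^sup>2 * c = b\<^sup>2 / d * (2 + c / d)"
    using d by (simp add: power2_eq_square field_simps)
  moreover have "c / d \<ge> -1"
    using d by (simp add: field_simps)
  ultimately have "2 * (b / d) * b + (b / d)\<^sup>2 * c > 0"
    using b d by (simp add: mult_pos_pos)
  with le[of "b / d"] show False by simp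
qed

locale symmetric_op =
  fixes T :: "'a::euclidean_space \<Rightarrow> 'a"
  assumes linear: "linear T"
    and sym: "T x \<bullet> y = x \<bullet> T y"
begin

lemma add: "T (x + y) = T x + T y"
  and diff: "T (x - y) = T x - T y"
  and scale: "T (r *\<^sub>R x) = r *\<^sub>R T x"
  and zero: "T 0 = 0"
  using linear by (simp_all add: linear_add linear_diff linear_scale linear_0)

lemma form_commute: "T x \<bullet> y = T y \<bullet> x"
  using sym[of x y] by (simp add: inner_commute)

lemma form_add: "T (x + y) \<bullet> (x + y) = T x \<bullet> x + 2 * (T x \<bullet> y) + T y \<bullet> y"
  using sym[of y x] by (simp add: add inner_add inner_commute)

lemma form_scale: "T (r *\<^sub>R x) \<bullet> (r *\<^sub>R x) = r\<^sup>2 * (T x \<bullet> x)"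
  by (simp add: scale power2_eq_square)

definition pos_def_on :: "'a set \<Rightarrow> bool" where
  "pos_def_on S \<longleftrightarrow> (\<forall>x\<in>S. x \<noteq> 0 \<longrightarrow> T x \<bullet> x > 0)"

definition eigenspace :: "real \<Rightarrow> 'a set" where
  "eigenspace l = {x. T x = l *\<^sub>R x}"

definition pos_eigenvalues :: "real set" where
  "pos_eigenvalues = {l. l > 0 \<and> (\<exists>x. x \<noteq> 0 \<and> T x = l *\<^sub>R x)}"

lemma symmetric_op_neg: "symmetric_op (\<lambda>x. - T x)"
  by unfold_locales (auto intro!: linearI simp: add scale sym)

text \<open>The form attains its maximum on the compact unit sphere of \<open>S\<close>. At a
  maximiser \<open>e\<close> the residual \<open>T e - l *\<^sub>R e\<close> again lies in
  \<open>S\<close>, and unless it vanishes, moving along it would raise the Rayleigh quotient to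
  first order.\<close>

lemma max_eigenvector:
  assumes S: "subspace S" "\<And>x. x \<in> S \<Longrightarrow> T x \<in> S" "S \<noteq> {0}"
  obtains e l where "e \<in> S" "e \<noteq> 0" "T e = l *\<^sub>R e"
    "\<And>x. x \<in> S \<Longrightarrow> T x \<bullet> x \<le> l * (x \<bullet> x)"
proof -
  let ?K = "S \<inter> sphere 0 1"
  obtain a where a: "a \<in> S" "a \<noteq> 0"
    using S subspace_0 by blast
  have "compact ?K"
    using S(1) by (simp add: closed_Int_compact closed_subspace)
  moreover have "(1 / norm a) *\<^sub>R a \<in> ?K"
    using a S(1) by (auto simp: subspace_scale)
  moreover have "continuous_on ?K (\<lambda>x. T x \<bullet> x)"
    by (intro continuous_intros linear_continuous_on_compose[OF continuous_on_id linear])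
  ultimately obtain e where e: "e \<in> ?K" and max: "\<And>x. x \<in> ?K \<Longrightarrow> T x \<bullet> x \<le> T e \<bullet> e"
    using continuous_attains_sup[of ?K "\<lambda>x. T x \<bullet> x"] by blast
  define l where "l = T e \<bullet> e"
  have le: "T x \<bullet> x \<le> l * (x \<bullet> x)" if "x \<in> S" for x
  proof (cases "x = 0")
    case False
    then have "(1 / norm x) *\<^sub>R x \<in> ?K"
      using that S(1) by (auto simp: subspace_scale)
    from max[OF this] have "(1 / norm x)\<^sup>2 * (T x \<bullet> x) \<le> l"
      by (simp only: form_scale l_def)
    with False show ?thesis
      by (simp add: power2_norm_eq_inner power_divide field_simps)
  qed (simp add: zero)
  have e1: "e \<in> S" "e \<bullet> e = 1"
    using e by (auto simp: dot_square_norm)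
  define y where "y = T e - l *\<^sub>R e"
  have y: "y \<in> S"
    unfolding y_def using e1 S by (simp add: subspace_diff subspace_scale)
  have ye: "e \<bullet> y = 0" "T e \<bullet> y = y \<bullet> y"
    using e1 by (auto simp: y_def l_def inner_diff inner_commute)
  \<comment> \<open>This is the bound \<open>le\<close> at \<open>e + t *\<^sub>R y\<close>; the
    constant terms cancel, and the linear coefficient is
    \<open>T e \<bullet> y = y \<bullet> y\<close>.\<close>
  have "2 * t * (y \<bullet> y) + t\<^sup>2 * (T y \<bullet> y - l * (y \<bullet> y)) \<le> 0" for t
  proof -
    have "T (e + t *\<^sub>R y) \<bullet> (e + t *\<^sub>R y) \<le> l * ((e + t *\<^sub>R y) \<bullet> (e + t *\<^sub>R y))"
      using e1 y S(1) by (intro le) (simp add: subspace_add subspace_scale)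
    moreover have "(e + t *\<^sub>R y) \<bullet> (e + t *\<^sub>R y) = 1 + t\<^sup>2 * (y \<bullet> y)"
      using e1 ye by (simp add: inner_add inner_commute power2_eq_square)
    ultimately have "l + 2 * (t * (y \<bullet> y)) + t\<^sup>2 * (T y \<bullet> y) \<le> l * (1 + t\<^sup>2 * (y \<bullet> y))"
      by (simp add: form_add form_scale ye l_def power2_eq_square scale)
    then show ?thesis
      by (simp add: algebra_simps)
  qed
  from quadratic_nonpos_imp_zero[OF this] have "y = 0" by simp
  then show thesis
    using that[of e l] e1 le by (force simp: y_def)
qed

section \<open>Positive eigenspaces and maximal positive definite subspaces\<close>

lemma eigenspace_orthogonal:
  assumes "x \<in> eigenspace l" "y \<in> eigenspace m" "l \<noteq> m"
  shows "x \<bullet> y = 0"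
proof -
  have "l * (x \<bullet> y) = m * (x \<bullet> y)"
    using sym[of x y] assms by (simp add: eigenspace_def)
  with assms show ?thesis by simp
qed

text \<open>One eigenvector per eigenvalue gives an orthogonal, hence independent, family.\<close>

lemma finite_pos_eigenvalues: "finite pos_eigenvalues"
proof -
  obtain e where e: "\<And>l. l \<in> pos_eigenvalues \<Longrightarrow> e l \<noteq> 0 \<and> e l \<in> eigenspace l"
  proof -
    have "\<forall>l\<in>pos_eigenvalues. \<exists>x. x \<noteq> 0 \<and> x \<in> eigenspace l"
      by (auto simp: pos_eigenvalues_def eigenspace_def)
    from bchoice[OF this] show thesis using that by blast
  qed
  have orth: "e l \<bullet> e m = 0" if "l \<in> pos_eigenvalues" "m \<in> pos_eigenvalues" "l \<noteq> m" for l m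
    using that e eigenspace_orthogonal by blast
  have "independent (e ` pos_eigenvalues)"
  proof (rule pairwise_orthogonal_independent)
    show "pairwise orthogonal (e ` pos_eigenvalues)"
      unfolding pairwise_image using orth by (auto simp: pairwise_def orthogonal_def)
    show "0 \<notin> e ` pos_eigenvalues"
      using e by force
  qed
  then have "finite (e ` pos_eigenvalues)"
    using independent_imp_finite by blast
  moreover have "inj_on e pos_eigenvalues"
  proof (rule inj_onI, rule ccontr)
    fix l m assume "l \<in> pos_eigenvalues" "m \<in> pos_eigenvalues" "e l = e m" "l \<noteq> m"
    with e[of l] orth[of l m] show False by simp
  qed
  ultimately show ?thesis
    by (rule finite_imageD)
qed

text \<open>\<open>dim\<close> of a set is the dimension of its span, so the union stands for the
  sum of the eigenspaces, which is orthogonal.\<close>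

lemma dim_UN_eigenspaces:
  assumes "finite L"
  shows "dim (\<Union>l\<in>L. eigenspace l) = (\<Sum>l\<in>L. dim (eigenspace l))"
  using assms
proof (induction L)
  case (insert m L)
  have "dim (eigenspace m \<union> (\<Union>l\<in>L. eigenspace l)) =
      dim (eigenspace m) + dim (\<Union>l\<in>L. eigenspace l)"
    using insert by (intro dim_orthogonal_sum) (auto intro: eigenspace_orthogonal)
  with insert show ?case by simp
qed simp

definition pos_space :: "'a set" where
  "pos_space = span (\<Union>l\<in>pos_eigenvalues. eigenspace l)"

lemma dim_pos_space: "dim pos_space = (\<Sum>l\<in>pos_eigenvalues. dim (eigenspace l))"
  by (simp add: pos_space_def dim_UN_eigenspaces finite_pos_eigenvalues)

lemma subspace_pos_space: "subspace pos_space"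
  by (simp add: pos_space_def)

lemma eigenvector_in_pos_space:
  assumes "T x = l *\<^sub>R x" "l > 0"
  shows "x \<in> pos_space"
proof (cases "x = 0")
  case False
  with assms have "l \<in> pos_eigenvalues" "x \<in> eigenspace l"
    by (auto simp: pos_eigenvalues_def eigenspace_def)
  then show ?thesis
    unfolding pos_space_def by (auto intro: span_base)
qed (simp add: pos_space_def span_zero)

lemma pos_space_invariant:
  assumes "x \<in> pos_space"
  shows "T x \<in> pos_space"
proof -
  have "subspace (T -` pos_space)"
    by (rule linear_subspace_vimage[OF linear subspace_pos_space])
  moreover have "(\<Union>l\<in>pos_eigenvalues. eigenspace l) \<subseteq> T -` pos_space"
    by (auto simp: eigenspace_def pos_space_def intro: span_base span_scale)
  ultimately show ?thesis
    using span_minimal[of _ "T -` pos_space"] assms by (auto simp: pos_space_def)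
qed

lemma orthogonal_pos_space:
  assumes "T x = l *\<^sub>R x" "l \<le> 0" "y \<in> pos_space"
  shows "x \<bullet> y = 0"
proof -
  have "orthogonal x y"
    using assms(3) unfolding pos_space_def
  proof (rule orthogonal_to_span)
    fix z assume "z \<in> (\<Union>l\<in>pos_eigenvalues. eigenspace l)"
    then obtain m where "m > 0" "z \<in> eigenspace m"
      by (auto simp: pos_eigenvalues_def)
    with assms show "orthogonal x z"
      using eigenspace_orthogonal[of x l z m] by (auto simp: eigenspace_def orthogonal_def)
  qed
  then show ?thesis by (simp add: orthogonal_def)
qed

text \<open>The minimum of the Rayleigh quotient on this invariant subspace is attained at an
  eigenvector. Were its eigenvalue nonpositive, the eigenvector would be orthogonal to
  \<open>pos_space\<close>, hence to itself.\<close>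

lemma pos_def_pos_space: "pos_def_on pos_space"
proof (cases "pos_space = {0}")
  case False
  \<comment> \<open>Negating \<open>T\<close> turns the minimum into a maximum; the least value is
    \<open>- l\<close>.\<close>
  interpret neg: symmetric_op "\<lambda>x. - T x" by (rule symmetric_op_neg)
  obtain e l where e: "e \<in> pos_space" "e \<noteq> 0" "- T e = l *\<^sub>R e"
    and le: "\<And>x. x \<in> pos_space \<Longrightarrow> - T x \<bullet> x \<le> l * (x \<bullet> x)"
    using neg.max_eigenvector[OF subspace_pos_space _ False]
      pos_space_invariant subspace_neg[OF subspace_pos_space] by metis
  have Te: "T e = (- l) *\<^sub>R e"
    using e(3) by (metis minus_minus scaleR_minus_left)
  have "l < 0"
    using orthogonal_pos_space[OF Te _ e(1)] e(2) by force
  show ?thesis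
    unfolding pos_def_on_def
  proof (intro ballI impI)
    fix x assume "x \<in> pos_space" "x \<noteq> 0"
    then have "- (T x \<bullet> x) \<le> l * (x \<bullet> x)" "l * (x \<bullet> x) < 0"
      using le[of x] \<open>l < 0\<close> by (auto simp: mult_neg_pos)
    then show "T x \<bullet> x > 0" by linarith
  qed
qed (simp add: pos_def_on_def)

text \<open>By symmetry the orthogonal complement of \<open>pos_space\<close> is invariant, so its
  maximum is an eigenvalue. A positive one would put the eigenvector into \<open>pos_space\<close>
  as well.\<close>

lemma form_nonpos_orthogonal_pos_space:
  assumes "\<And>y. y \<in> pos_space \<Longrightarrow> x \<bullet> y = 0"
  shows "T x \<bullet> x \<le> 0"
proof (cases "x = 0")
  case False
  define S where "S = {x. \<forall>y\<in>pos_space. orthogonal y x}"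
  have xS: "x \<in> S"
    using assms by (auto simp: S_def orthogonal_def inner_commute)
  have S: "subspace S"
    unfolding S_def by (rule subspace_orthogonal_to_vectors)
  have "T y \<in> S" if "y \<in> S" for y
    using that pos_space_invariant sym by (fastforce simp: S_def orthogonal_def)
  then obtain e l where e: "e \<in> S" "e \<noteq> 0" "T e = l *\<^sub>R e"
    and le: "\<And>x. x \<in> S \<Longrightarrow> T x \<bullet> x \<le> l * (x \<bullet> x)"
    using max_eigenvector[OF S] xS False by blast
  have "l \<le> 0"
  proof (rule ccontr)
    assume "\<not> l \<le> 0"
    then have "e \<in> pos_space"
      using e eigenvector_in_pos_space by simp
    with e show False by (auto simp: S_def orthogonal_def)
  qed
  then show ?thesis
    using le[OF xS] mult_nonpos_nonneg[of l "x \<bullet> x"] by simp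
qed (simp add: zero)

text \<open>The form is nonpositive on the orthogonal complement of \<open>pos_space\<close>, so a
  positive definite \<open>Q\<close> meets that complement only in 0.\<close>

lemma pos_def_dim_le:
  assumes Q: "subspace Q" "pos_def_on Q"
  shows "dim Q \<le> dim pos_space"
proof -
  define N where "N = {x. \<forall>y\<in>pos_space. orthogonal y x}"
  have N: "subspace N"
    unfolding N_def by (rule subspace_orthogonal_to_vectors)
  have dimN: "dim N + dim pos_space = DIM('a)"
    using dim_subspace_orthogonal_to_vectors[OF subspace_pos_space subspace_UNIV]
    by (simp add: N_def)
  have "x = 0" if "x \<in> Q" "x \<in> N" for x
    using form_nonpos_orthogonal_pos_space[of x] that Q(2)
    by (force simp: N_def orthogonal_def pos_def_on_def inner_commute)
  then have "Q \<inter> N = {0}"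
    using N Q by (auto simp: subspace_0)
  then have "dim Q + dim N \<le> DIM('a)"
    using dim_sums_Int[OF Q(1) N] dim_subset_UNIV[of "{x + y |x y. x \<in> Q \<and> y \<in> N}"] by simp
  with dimN show ?thesis by simp
qed

text \<open>Orthogonality here refers to the form of \<open>T\<close>, not to the inner product, so
  \<open>S \<inter> perp S\<close> is the radical of \<open>S\<close> and may be nonzero.\<close>

definition perp :: "'a set \<Rightarrow> 'a set" where
  "perp S = {x. \<forall>y\<in>S. T x \<bullet> y = 0}"

lemma subspace_perp: "subspace (perp S)"
  by (auto simp: perp_def subspace_def add zero scale inner_add_left)

lemma perp_decomp:
  assumes inj: "inj T" and S: "subspace S" "S \<inter> perp S = {0}"
  obtains s u where "s \<in> S" "u \<in> perp S" "x = s + u"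
proof -
  have "perp S = {y. \<forall>x\<in>T ` S. orthogonal x y}"
    by (simp add: perp_def orthogonal_def form_commute)
  moreover have "subspace (T ` S)"
    using linear S(1) by (rule linear_subspace_image)
  ultimately have "dim (perp S) + dim (T ` S) = DIM('a)"
    using dim_subspace_orthogonal_to_vectors[of "T ` S" UNIV] by simp
  moreover have "dim (T ` S) = dim S"
    using inj by (intro dim_image_eq linear) (auto intro: inj_on_subset)
  ultimately have "dim {x + y |x y. x \<in> S \<and> y \<in> perp S} = DIM('a)"
    using dim_sums_Int[OF S(1) subspace_perp[of S]] S(2) by simp
  then have "span {x + y |x y. x \<in> S \<and> y \<in> perp S} = UNIV"
    by (simp only: dim_eq_full)
  then have "{x + y |x y. x \<in> S \<and> y \<in> perp S} = UNIV"
    by (simp only: span_eq_iff[THEN iffD2, OF subspace_sums[OF S(1) subspace_perp]])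
  then have "x \<in> {x + y |x y. x \<in> S \<and> y \<in> perp S}"
    by simp
  then show thesis
    using that by (elim CollectE exE conjE)
qed

text \<open>Otherwise polarisation makes \<open>perp S\<close> orthogonal to itself, hence to
  \<open>S + perp S\<close>, the whole space. Injectivity then gives \<open>perp S = {0}\<close> and
  \<open>S = UNIV\<close>.\<close>

lemma perp_anisotropic_vector:
  assumes inj: "inj T" and S: "subspace S" "S \<inter> perp S = {0}" "S \<noteq> UNIV"
  obtains v where "v \<in> perp S" "T v \<bullet> v \<noteq> 0"
proof (cases "\<exists>v\<in>perp S. T v \<bullet> v \<noteq> 0")
  case False
  then have iso: "T v \<bullet> v = 0" if "v \<in> perp S" for v
    using that by blast
  have "v = 0" if v: "v \<in> perp S" for v
  proof -
    have "T v \<bullet> x = 0" for x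
    proof -
      obtain s u where x: "s \<in> S" "u \<in> perp S" "x = s + u"
        using perp_decomp[OF inj S(1,2)] by blast
      have "T v \<bullet> s = 0"
        using v x by (simp add: perp_def)
      moreover have "T v \<bullet> u = 0"
        using form_add[of v u] iso[of v] iso[of u] iso[of "v + u"] v x
          subspace_add[OF subspace_perp] by simp
      ultimately show ?thesis
        by (simp add: x inner_add_right)
    qed
    from this[of "T v"] have "T v = T 0" by (simp add: zero)
    with inj show ?thesis by (simp add: inj_eq)
  qed
  then have "S = UNIV"
    using perp_decomp[OF inj S(1,2)] by (metis UNIV_eq_I add.right_neutral)
  with S show thesis by simp
qed (use that in blast)

end

section \<open>Quaternion vectors as a Euclidean space\<close>

instantiation quat :: real_vector
begin

definition scaleR_quat :: "real \<Rightarrow> quat \<Rightarrow> quat" where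
  "r *\<^sub>R x = qreal r * x"

instance
  by standard (auto simp: scaleR_quat_def quat_eq_iff algebra_simps)

end

instantiation quat :: real_inner
begin

text \<open>The order of the factors matches \<open>qform\<close>, so that
  \<open>qRe (qform H x y)\<close> is the inner product of \<open>H *v x\<close> and
  \<open>y\<close>.\<close>

definition inner_quat_def:
  "(x::quat) \<bullet> y = qRe (qcnj y * x)"

definition norm_quat_def:
  "norm (x::quat) = sqrt (x \<bullet> x)"

definition sgn_quat_def:
  "sgn (x::quat) = x /\<^sub>R norm x"

definition dist_quat_def:
  "dist (x::quat) y = norm (x - y)"

definition uniformity_quat_def:
  "uniformity = (INF e\<in>{0<..}. principal {(x::quat, y). dist x y < e})"

definition open_quat_def:
  "open (U :: quat set) \<longleftrightarrow> (\<forall>x\<in>U. eventually (\<lambda>(x', y). x' = x \<longrightarrow> y \<in> U) uniformity)"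

instance
proof
  fix x y z :: quat and r :: real
  have sq: "x \<bullet> x = (qRe x)\<^sup>2 + (qI x)\<^sup>2 + (qJ x)\<^sup>2 + (qK x)\<^sup>2"
    by (simp add: inner_quat_def power2_eq_square)
  show "0 \<le> x \<bullet> x"
    by (simp add: sq)
  show "x \<bullet> x = 0 \<longleftrightarrow> x = 0"
    by (simp add: sq add_nonneg_eq_0_iff quat_eq_iff)
  show "x \<bullet> y = y \<bullet> x" "(x + y) \<bullet> z = x \<bullet> z + y \<bullet> z" "(r *\<^sub>R x) \<bullet> y = r * (x \<bullet> y)"
    by (simp_all add: inner_quat_def scaleR_quat_def algebra_simps)
qed (simp_all only: norm_quat_def sgn_quat_def dist_quat_def uniformity_quat_def open_quat_def)

end

instantiation quat :: euclidean_space
begin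

definition Basis_quat :: "quat set" where
  "Basis = {1, Quat 0 1 0 0, Quat 0 0 1 0, Quat 0 0 0 1}"

instance
proof
  fix x u v :: quat
  show "(Basis :: quat set) \<noteq> {}" "finite (Basis :: quat set)"
    by (simp_all add: Basis_quat_def)
  show "(\<forall>u\<in>Basis. x \<bullet> u = 0) \<longleftrightarrow> x = 0"
    unfolding Basis_quat_def ball_simps by (simp add: inner_quat_def quat_eq_iff[of x])
  assume "u \<in> Basis" "v \<in> Basis"
  then show "u \<bullet> v = (if u = v then 1 else 0)"
    unfolding Basis_quat_def by (elim insertE emptyE) (simp_all add: inner_quat_def quat_eq_iff)
qed

end

lemma DIM_quat [simp]: "DIM(quat) = 4"
proof -
  have "1 \<noteq> Quat 0 1 0 0" "1 \<noteq> Quat 0 0 1 0" "1 \<noteq> Quat 0 0 0 1"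
    by (simp_all add: quat_eq_iff)
  then show ?thesis by (simp add: Basis_quat_def)
qed

lemma quat_scaleR_simps [simp]:
  "qRe (r *\<^sub>R x) = r * qRe x" "qI (r *\<^sub>R x) = r * qI x"
  "qJ (r *\<^sub>R x) = r * qJ x" "qK (r *\<^sub>R x) = r * qK x"
  by (simp_all add: scaleR_quat_def)

lemma mult_scaleR_quat: "(r *\<^sub>R x) * y = r *\<^sub>R (x * y)" "x * (r *\<^sub>R y) = r *\<^sub>R (x * y)"
  for x y :: quat
  by (simp_all add: quat_eq_iff algebra_simps)

lemma qcnj_simps [simp]:
  "qcnj 0 = 0" "qcnj (x + y) = qcnj x + qcnj y" "qcnj (x * y) = qcnj y * qcnj x"
  "qcnj (qcnj x) = x"
  by (simp_all add: quat_eq_iff algebra_simps)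

lemma qcnj_sum: "qcnj (sum f A) = (\<Sum>x\<in>A. qcnj (f x))"
  by (induction A rule: infinite_finite_induct) auto

lemma qRe_sum: "qRe (sum f A) = (\<Sum>x\<in>A. qRe (f x))"
  by (induction A rule: infinite_finite_induct) auto

lemma quat_right_inverse:
  assumes "c \<noteq> 0"
  obtains d :: quat where "c * d = 1"
proof
  have "c \<bullet> c \<noteq> 0"
    using assms by simp
  then have "(qRe c)\<^sup>2 + (qI c)\<^sup>2 + (qJ c)\<^sup>2 + (qK c)\<^sup>2 \<noteq> 0"
    by (simp add: inner_quat_def power2_eq_square)
  then show "c * (qcnj c /\<^sub>R ((qRe c)\<^sup>2 + (qI c)\<^sup>2 + (qJ c)\<^sup>2 + (qK c)\<^sup>2)) = 1"
    by (simp add: quat_eq_iff power2_eq_square divide_simps)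
qed

text \<open>Multiplying by 1, i, j and k moves each coordinate in turn, up to sign, into the real
  part.\<close>

lemma quat_eqI_qRe:
  assumes "\<And>c. qRe (c * x) = qRe (c * y)"
  shows "x = y"
  using assms[of 1] assms[of "Quat 0 1 0 0"] assms[of "Quat 0 0 1 0"] assms[of "Quat 0 0 0 1"]
  by (simp add: quat_eq_iff)

lemma rscale_simps:
  "(x + y) *r c = x *r c + y *r c" "x *r (c + d) = x *r c + x *r d"
  "x *r c *r d = x *r (c * d)" "x *r 1 = x" "x *r 0 = 0" "0 *r c = 0"
  "(- x) *r c = - (x *r c)" "x *r (- c) = - (x *r c)"
  "(x - y) *r c = x *r c - y *r c" "x *r (c - d) = x *r c - x *r d"
  by (simp_all add: rscale_def vec_eq_iff algebra_simps)

lemma rscale_scaleR: "(r *\<^sub>R x) *r c = r *\<^sub>R (x *r c)" "x *r (r *\<^sub>R c) = r *\<^sub>R (x *r c)"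
  by (simp_all add: rscale_def vec_eq_iff mult_scaleR_quat)

lemma rscale_qreal: "x *r qreal r = r *\<^sub>R x"
  by (simp add: rscale_def vec_eq_iff quat_eq_iff algebra_simps)

lemma rscale_eq_0_iff: "x *r c = 0 \<longleftrightarrow> x = 0 \<or> c = 0"
proof (cases "c = 0")
  case False
  then obtain d where "c * d = 1" by (rule quat_right_inverse)
  then have "x = x *r c *r d" by (simp add: rscale_simps)
  then show ?thesis
    using False by (metis rscale_simps(6))
qed (simp add: rscale_simps)

lemma rscale_in_rsubspaceD:
  assumes "rsubspace S" "x *r c \<in> S" "c \<noteq> 0"
  shows "x \<in> S"
proof -
  from \<open>c \<noteq> 0\<close> obtain d where "c * d = 1" by (rule quat_right_inverse)
  then have "x = x *r c *r d" by (simp add: rscale_simps)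
  then show ?thesis
    using assms by (metis rsubspace_def)
qed

lemma rsubspace_imp_subspace: "rsubspace S \<Longrightarrow> subspace S"
  by (auto simp: rsubspace_def subspace_def simp flip: rscale_qreal)

lemma rsubspace_sum:
  "rsubspace S \<Longrightarrow> (\<And>i. i \<in> A \<Longrightarrow> f i \<in> S) \<Longrightarrow> sum f A \<in> S"
  by (rule subspace_sum[OF rsubspace_imp_subspace])

section \<open>Quaternionic and real dimension\<close>

text \<open>Coefficients form a list, as in \<open>rindep\<close>, so that both can be analysed by
  induction on the vectors.\<close>

definition rspan :: "(quat ^ 'n) list \<Rightarrow> (quat ^ 'n) set" where
  "rspan vs = {\<Sum>k<length vs. vs ! k *r cs ! k |cs. length cs = length vs}"

lemma rspan_Nil [simp]: "rspan [] = {0}"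
  by (simp add: rspan_def)

lemma rspan_Cons: "rspan (v # vs) = {x + y |x y. x \<in> range (\<lambda>c. v *r c) \<and> y \<in> rspan vs}"
proof -
  have "(\<exists>cs. P cs \<and> length cs = Suc n) \<longleftrightarrow> (\<exists>c cs. P (c # cs) \<and> length cs = n)"
    for P :: "quat list \<Rightarrow> bool" and n
    by (metis length_Suc_conv length_Cons)
  then show ?thesis
    by (fastforce simp: rspan_def sum.lessThan_Suc_shift simp del: sum.lessThan_Suc)
qed

lemma rindep_Nil [simp]: "rindep []"
  by (simp add: rindep_def)

lemma rsubspace_rspan: "rsubspace (rspan vs)"
proof (induction vs)
  case (Cons v vs)
  show ?case
    unfolding rsubspace_def
  proof (intro conjI ballI allI)
    show "0 \<in> rspan (v # vs)"
      using Cons by (auto simp: rspan_Cons rsubspace_def intro!: exI[of _ 0] image_eqI[of _ _ 0] rscale_simps)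
  next
    fix x y assume "x \<in> rspan (v # vs)" "y \<in> rspan (v # vs)"
    then obtain c d a b where "x = v *r c + a" "y = v *r d + b" "a \<in> rspan vs" "b \<in> rspan vs"
      by (auto simp: rspan_Cons)
    moreover from this have "x + y = v *r (c + d) + (a + b)"
      by (simp add: rscale_simps)
    ultimately show "x + y \<in> rspan (v # vs)"
      using Cons unfolding rspan_Cons rsubspace_def by blast
  next
    fix x c assume "x \<in> rspan (v # vs)"
    then obtain d a where "x = v *r d + a" "a \<in> rspan vs"
      by (auto simp: rspan_Cons)
    moreover from this have "x *r c = v *r (d * c) + a *r c"
      by (simp add: rscale_simps)
    ultimately show "x *r c \<in> rspan (v # vs)"
      using Cons unfolding rspan_Cons rsubspace_def by blast
  qed
qed (simp add: rsubspace_def rscale_simps)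

text \<open>A nonzero coefficient of \<open>v\<close> in a relation is invertible, so the relation
  puts \<open>v\<close> into \<open>rspan vs\<close>. Conversely, membership in the span is a
  relation with coefficient -1.\<close>

lemma rindep_Cons: "rindep (v # vs) \<longleftrightarrow> rindep vs \<and> v \<notin> rspan vs"
proof
  assume ind: "rindep (v # vs)"
  have ind': "c = 0 \<and> (\<forall>k<length vs. cs ! k = 0)"
    if "length cs = length vs" "v *r c + (\<Sum>k<length vs. vs ! k *r cs ! k) = 0" for c cs
  proof -
    have "(\<Sum>k<length (v # vs). (v # vs) ! k *r (c # cs) ! k) = 0"
      using that by (simp add: sum.lessThan_Suc_shift del: sum.lessThan_Suc)
    moreover have "length (c # cs) = length (v # vs)"
      using that by simp
    ultimately have zero: "(c # cs) ! k = 0" if "k < length (v # vs)" for k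
      using ind that unfolding rindep_def by blast
    show ?thesis
      using zero[of 0] zero[of "Suc k" for k] by auto
  qed
  have "rindep vs"
    unfolding rindep_def
  proof (intro allI impI)
    fix cs k assume "length cs = length vs" "(\<Sum>k<length vs. vs ! k *r cs ! k) = 0" "k < length vs"
    then show "cs ! k = 0"
      using ind'[of cs 0] by (simp add: rscale_simps)
  qed
  moreover have "v \<notin> rspan vs"
  proof
    assume "v \<in> rspan vs"
    then obtain cs where "length cs = length vs" "v = (\<Sum>k<length vs. vs ! k *r cs ! k)"
      by (auto simp: rspan_def)
    then show False
      using ind'[of cs "- 1"] by (simp add: rscale_simps)
  qed
  ultimately show "rindep vs \<and> v \<notin> rspan vs" ..
next
  assume r: "rindep vs \<and> v \<notin> rspan vs"
  show "rindep (v # vs)"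
    unfolding rindep_def
  proof (intro allI impI)
    fix cs k
    assume "length cs = length (v # vs)"
      and sum: "(\<Sum>k<length (v # vs). (v # vs) ! k *r cs ! k) = 0" and k: "k < length (v # vs)"
    then obtain c ds where cs: "cs = c # ds" "length ds = length vs"
      by (metis length_Suc_conv length_Cons)
    let ?s = "\<Sum>k<length vs. vs ! k *r ds ! k"
    have s: "v *r c + ?s = 0"
      using sum cs by (simp add: sum.lessThan_Suc_shift del: sum.lessThan_Suc)
    have "?s \<in> rspan vs"
      using cs by (auto simp: rspan_def)
    then have "(- ?s) \<in> rspan vs"
      using rsubspace_imp_subspace[OF rsubspace_rspan] subspace_neg by blast
    moreover have "v *r c = - ?s"
      using s by (rule eq_neg_iff_add_eq_0[THEN iffD2])
    ultimately have c: "c = 0"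
      using rscale_in_rsubspaceD[OF rsubspace_rspan, of v c vs] r by auto
    then have "?s = 0"
      using s by (simp add: rscale_simps)
    then have "\<forall>k<length vs. ds ! k = 0"
      using r cs unfolding rindep_def by blast
    then show "cs ! k = 0"
      using c cs k by (cases k) auto
  qed
qed

lemma dim_range_rscale:
  assumes "v \<noteq> 0"
  shows "dim (range (\<lambda>c. v *r c)) = 4"
proof -
  have "linear (\<lambda>c. v *r c)"
    by (intro linearI) (simp_all add: rscale_simps rscale_scaleR)
  moreover have "inj (\<lambda>c. v *r c)"
  proof (rule injI)
    fix c d assume "v *r c = v *r d"
    then have "v *r (c - d) = 0" by (simp add: rscale_simps)
    with assms show "c = d" by (simp add: rscale_eq_0_iff)
  qed
  ultimately have "dim (range (\<lambda>c. v *r c)) = dim (UNIV :: quat set)"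
    by (intro dim_image_eq) (auto intro: inj_on_subset)
  then show ?thesis by simp
qed

text \<open>Each new vector contributes a quaternionic line, of real dimension 4, that meets the
  previous span only in 0.\<close>

lemma dim_rspan:
  assumes "rindep vs"
  shows "dim (rspan vs) = 4 * length vs"
  using assms
proof (induction vs)
  case (Cons v vs)
  then have v: "v \<notin> rspan vs" and vs: "rindep vs"
    by (auto simp: rindep_Cons)
  have "v \<noteq> 0"
    using v rsubspace_rspan[of vs] by (auto simp: rsubspace_def)
  have "subspace (range (\<lambda>c. v *r c))"
    by (intro linear_subspace_image linearI) (simp_all add: rscale_simps rscale_scaleR)
  moreover have "range (\<lambda>c. v *r c) \<inter> rspan vs \<subseteq> {0}"
  proof (intro subsetI, elim IntE rangeE)
    fix x c assume "x \<in> rspan vs" "x = v *r c"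
    then have "c = 0"
      using rscale_in_rsubspaceD[OF rsubspace_rspan, of v c vs] v by blast
    with \<open>x = v *r c\<close> show "x \<in> {0}" by (simp add: rscale_simps)
  qed
  then have "dim (range (\<lambda>c. v *r c) \<inter> rspan vs) = 0"
    by (simp only: dim_eq_0)
  ultimately have "dim (rspan (v # vs)) = 4 + dim (rspan vs)"
    using dim_sums_Int[of "range (\<lambda>c. v *r c)" "rspan vs"] dim_range_rscale[OF \<open>v \<noteq> 0\<close>]
    by (simp add: rspan_Cons rsubspace_imp_subspace rsubspace_rspan del: dim_eq_0)
  with Cons vs show ?case by simp
qed simp

lemma rspan_subset:
  assumes "rsubspace S" "set vs \<subseteq> S"
  shows "rspan vs \<subseteq> S"
proof -
  have "vs ! k *r c \<in> S" if "k < length vs" for k c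
    using assms that unfolding rsubspace_def by (meson nth_mem subsetD)
  then show ?thesis
    using assms(1) by (auto simp: rspan_def intro!: rsubspace_sum)
qed

text \<open>An independent list of maximal length in \<open>S\<close> spans \<open>S\<close>, since
  any vector outside its span could be prepended.\<close>

lemma qdim_dim:
  fixes S :: "(quat ^ 'n) set"
  assumes "rsubspace S"
  shows "4 * qdim S = dim S"
proof -
  let ?L = "{length vs |vs. set vs \<subseteq> S \<and> rindep vs}"
  \<comment> \<open>This bound makes the set of lengths finite, so that its \<open>Max\<close> is
    attained.\<close>
  have le: "4 * length vs \<le> dim S" if "set vs \<subseteq> S" "rindep vs" for vs
    using dim_rspan[OF that(2)] dim_subset[OF rspan_subset[OF assms that(1)]] by simp
  then have "?L \<subseteq> {..dim S}"
    by force
  then have fin: "finite ?L"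
    by (rule finite_subset) simp
  have "length [] \<in> ?L"
    by force
  then have "qdim S \<in> ?L"
    unfolding qdim_def using Max_in[OF fin] by blast
  then obtain vs where vs: "qdim S = length vs" "set vs \<subseteq> S" "rindep vs"
    by blast
  have "S \<subseteq> rspan vs"
  proof (rule ccontr)
    assume "\<not> S \<subseteq> rspan vs"
    then obtain v where "v \<in> S" "v \<notin> rspan vs" by blast
    then have "length (v # vs) \<in> ?L"
      using vs by (intro CollectI exI[of _ "v # vs"]) (simp add: rindep_Cons)
    then have "length (v # vs) \<le> qdim S"
      unfolding qdim_def using Max_ge[OF fin] by blast
    with vs show False by simp
  qed
  then have "rspan vs = S"
    using rspan_subset[OF assms vs(2)] by blast
  with dim_rspan[OF vs(3)] vs(1) show ?thesis by simp
qed

section \<open>Hermitian forms\<close>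

lemma matrix_mult_rscale: "H *v (x *r c) = (H *v x) *r c"
  by (simp add: matrix_vector_mult_def rscale_def vec_eq_iff sum_distrib_right mult.assoc)

lemma qform_add:
  "qform H (x + y) z = qform H x z + qform H y z"
  "qform H x (y + z) = qform H x y + qform H x z"
  by (simp_all add: qform_def matrix_vector_right_distrib algebra_simps sum.distrib)

lemma qform_rscale:
  "qform H (x *r c) y = qform H x y * c"
  "qform H x (y *r c) = qcnj c * qform H x y"
  by (simp_all add: qform_def matrix_mult_rscale)
    (simp_all add: rscale_def sum_distrib_left sum_distrib_right mult.assoc)

lemma qform_0 [simp]: "qform H 0 y = 0" "qform H x 0 = 0"
  using qform_rscale[of H _ 0 _] by (simp_all add: qform_def)

lemma qform_hermitian:
  assumes "qhermitian H"
  shows "qcnj (qform H x y) = qform H y x"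
proof -
  have H: "qcnj (H $ i $ j) = H $ j $ i" for i j
  proof -
    have "qadjoint H $ j $ i = H $ j $ i"
      using assms by (simp add: qhermitian_def)
    then show ?thesis by (simp add: qadjoint_def)
  qed
  have "qcnj (qform H x y) = (\<Sum>i\<in>UNIV. \<Sum>j\<in>UNIV. qcnj (x $ j) * H $ j $ i * y $ i)"
    by (simp add: qform_def matrix_vector_mult_def qcnj_sum sum_distrib_right H mult.assoc)
  also have "\<dots> = qform H y x"
    by (subst sum.swap) (simp add: qform_def matrix_vector_mult_def sum_distrib_left mult.assoc)
  finally show ?thesis .
qed

lemma qRe_qform: "qRe (qform H x y) = (H *v x) \<bullet> y"
  by (simp add: qform_def inner_vec_def inner_quat_def qRe_sum)

lemma qform_self:
  assumes "qhermitian H"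
  shows "qform H x x = qreal ((H *v x) \<bullet> x)"
  using qform_hermitian[OF assms, of x x] by (simp add: quat_eq_iff flip: qRe_qform)

text \<open>The real parts for all multiples of the second argument determine the quaternion. This
  carries real orthogonality over to quaternion-valued forms.\<close>

lemma qform_eqI:
  assumes "\<And>c. (H *v x) \<bullet> (y *r c) = (H' *v x') \<bullet> (y' *r c)"
  shows "qform H x y = qform H' x' y'"
proof (rule quat_eqI_qRe)
  fix c
  show "qRe (c * qform H x y) = qRe (c * qform H' x' y')"
    using assms[of "qcnj c"] by (simp add: qRe_qform[symmetric] qform_rscale)
qed

lemma symmetric_op_hermitian:
  assumes "qhermitian H"
  shows "symmetric_op ((*v) H)"
proof (rule symmetric_op.intro)
  show "linear ((*v) H)"
    by (intro linearI) (simp_all add: matrix_vector_right_distrib matrix_mult_rscale flip: rscale_qreal)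
  show "(H *v x) \<bullet> y = x \<bullet> (H *v y)" for x y
    using arg_cong[OF qform_hermitian[OF assms, of x y], of qRe]
    by (simp add: qRe_qform inner_commute)
qed

lemma inj_qinvertible: "qinvertible H \<Longrightarrow> inj ((*v) H)"
  unfolding qinvertible_def
  by (metis injI matrix_vector_mul_assoc matrix_vector_mul_lid)

lemma surj_qinvertible: "qinvertible H \<Longrightarrow> surj ((*v) H)"
  unfolding qinvertible_def
  by (metis surjI matrix_vector_mul_assoc matrix_vector_mul_lid)

lemma rsubspace_qeigenspace: "rsubspace (qeigenspace H l)"
  by (simp add: rsubspace_def qeigenspace_def matrix_vector_right_distrib matrix_mult_rscale
      rscale_simps rscale_qreal rscale_scaleR scaleR_add_right)

text \<open>Real eigenvalues and their eigenspaces are the same sets over the quaternions and over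
  the reals; only the dimension changes, by the factor 4.\<close>

lemma pos_inertia_dim:
  assumes "qhermitian H"
  shows "4 * pos_inertia H = dim (symmetric_op.pos_space ((*v) H))"
proof -
  interpret symmetric_op "(*v) H" by (rule symmetric_op_hermitian[OF assms])
  have "{l. l > 0 \<and> is_real_eigenvalue H l} = pos_eigenvalues"
    by (simp add: is_real_eigenvalue_def pos_eigenvalues_def rscale_qreal)
  moreover have "4 * qdim (qeigenspace H l) = dim (eigenspace l)" for l
    using qdim_dim[OF rsubspace_qeigenspace, of H l]
    by (simp add: qeigenspace_def eigenspace_def rscale_qreal)
  ultimately show ?thesis
    by (simp add: pos_inertia_def dim_pos_space sum_distrib_left)
qed

section \<open>Partial isometries\<close>

text \<open>Two values over the same point differ by a value over 0, so a choice of values is unique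
  and inherits linearity from \<open>K\<close>.\<close>

lemma linear_of_graph:
  fixes K :: "('a::real_vector \<times> 'b::real_vector) set"
  assumes K: "subspace K" and "Domain K = UNIV" and sv: "\<And>y. (0, y) \<in> K \<Longrightarrow> y = 0"
  shows "\<exists>F. linear F \<and> (\<forall>x. (x, F x) \<in> K)"
proof -
  have "\<forall>x. \<exists>y. (x, y) \<in> K"
    using assms(2) by blast
  then obtain F where F: "\<And>x. (x, F x) \<in> K"
    by metis
  have eq: "F x = y" if "(x, y) \<in> K" for x y
    using sv[of "F x - y"] subspace_diff[OF K F[of x] that] by simp
  have "linear F"
  proof (rule linearI)
    show "F (x + y) = F x + F y" for x y
      using subspace_add[OF K F[of x] F[of y]] by (intro eq) simp
    show "F (r *\<^sub>R x) = r *\<^sub>R F x" for r x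
      using subspace_scale[OF K F[of x], of r] by (intro eq) simp
  qed
  with F show ?thesis by blast
qed

text \<open>A partial isometry is represented by its graph \<open>G\<close>, so that the two spaces play
  symmetric roles and the inverse is the converse relation.\<close>

locale partial_isometry =
  fixes H1 H2 :: "quat ^ 'n ^ 'n" and G :: "((quat ^ 'n) \<times> (quat ^ 'n)) set"
  assumes herm1: "qhermitian H1" and inv1: "qinvertible H1"
    and herm2: "qhermitian H2" and inv2: "qinvertible H2"
    and zero: "(0, 0) \<in> G"
    and add: "(x, y) \<in> G \<Longrightarrow> (x', y') \<in> G \<Longrightarrow> (x + x', y + y') \<in> G"
    and scale: "(x, y) \<in> G \<Longrightarrow> (x *r c, y *r c) \<in> G"
    and form: "(x, y) \<in> G \<Longrightarrow> (x', y') \<in> G \<Longrightarrow> qform H1 x x' = qform H2 y y'"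
    and left0: "(0, y) \<in> G \<Longrightarrow> y = 0"
    and right0: "(x, 0) \<in> G \<Longrightarrow> x = 0"
begin

sublocale T1: symmetric_op "(*v) H1"
  by (rule symmetric_op_hermitian[OF herm1])

sublocale T2: symmetric_op "(*v) H2"
  by (rule symmetric_op_hermitian[OF herm2])

lemma partial_isometry_converse: "partial_isometry H2 H1 (G\<inverse>)"
  by unfold_locales
    (auto intro: herm1 herm2 inv1 inv2 zero add scale dest: left0 right0 form[symmetric])

lemma subspace_graph: "subspace G"
proof -
  have "(r *\<^sub>R x, r *\<^sub>R y) \<in> G" if "(x, y) \<in> G" for r x y
    using scale[OF that, of "qreal r"] by (simp add: rscale_qreal)
  then show ?thesis
    using zero add by (auto simp: subspace_def zero_prod_def)
qed

lemma rsubspace_Domain: "rsubspace (Domain G)"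
  using zero add scale by (fastforce simp: rsubspace_def Domain_iff)

lemma rsubspace_Range: "rsubspace (Range G)"
  using partial_isometry.rsubspace_Domain[OF partial_isometry_converse] by simp

text \<open>Both projections of the graph are injective, so domain and range have equal dimension
  and one is proper exactly when the other is.\<close>

lemma dim_Domain: "dim (Domain G) = dim G"
proof -
  have "inj_on fst G"
    using left0 by (auto simp: linear_injective_on_subspace_0[OF linear_fst subspace_graph] zero_prod_def)
  then have "dim (fst ` G) = dim G"
    using subspace_graph by (intro dim_image_eq linear_fst) (simp add: span_eq_iff[THEN iffD2])
  then show ?thesis by (simp add: Domain_fst)
qed

lemma dim_Range: "dim (Range G) = dim G"
proof -
  have "inj_on snd G"
    using right0 by (auto simp: linear_injective_on_subspace_0[OF linear_snd subspace_graph] zero_prod_def)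
  then have "dim (snd ` G) = dim G"
    using subspace_graph by (intro dim_image_eq linear_snd) (simp add: span_eq_iff[THEN iffD2])
  then show ?thesis by (simp add: Range_snd)
qed

lemma form_swap1: "qform H1 x y = 0 \<longleftrightarrow> qform H1 y x = 0"
  using qform_hermitian[OF herm1] qcnj_simps(1) by metis

text \<open>The domain is closed under right scalars, so vanishing of all real parts forces the
  whole quaternion to vanish.\<close>

lemma perp_Domain_iff: "x \<in> T1.perp (Domain G) \<longleftrightarrow> (\<forall>y\<in>Domain G. qform H1 x y = 0)"
proof
  assume x: "x \<in> T1.perp (Domain G)"
  show "\<forall>y\<in>Domain G. qform H1 x y = 0"
  proof
    fix y assume "y \<in> Domain G"
    then have "(H1 *v x) \<bullet> (y *r c) = 0" for c
      using x rsubspace_Domain by (auto simp: T1.perp_def rsubspace_def)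
    then have "qform H1 x y = qform H1 0 y"
      by (intro qform_eqI) (simp add: T1.zero)
    then show "qform H1 x y = 0" by simp
  qed
qed (simp add: T1.perp_def flip: qRe_qform)

text \<open>The functional \<open>[v, _]\<^sub>1\<close> on the domain transported to the range: the orthogonal complement
  of the graph projects onto the first factor because the graph contains no \<open>(x, 0)\<close>
  with \<open>x \<noteq> 0\<close>.\<close>

lemma transport_functional:
  "\<exists>w. \<forall>x y. (x, y) \<in> G \<longrightarrow> qform H1 v x = qform H2 w y"
proof -
  have "subspace (fst ` (G\<^sup>\<bottom>))"
    by (intro linear_subspace_image linear_fst subspace_orthogonal_comp)
  have "H1 *v v \<in> fst ` (G\<^sup>\<bottom>)"
  proof -
    \<comment> \<open>A vector orthogonal to the projection gives \<open>(z, 0)\<close> in the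
      double complement of \<open>G\<close>, which is \<open>G\<close> itself.\<close>
    have "z = 0" if z: "z \<in> (fst ` (G\<^sup>\<bottom>))\<^sup>\<bottom>" for z
    proof -
      have "(z, 0) \<in> G\<^sup>\<bottom>\<^sup>\<bottom>"
        using z by (auto simp: orthogonal_comp_def orthogonal_def)
      then show ?thesis
        using right0 orthogonal_comp_self[OF subspace_graph] by blast
    qed
    then have "(fst ` (G\<^sup>\<bottom>))\<^sup>\<bottom> \<subseteq> {0}"
      by blast
    then have "(fst ` (G\<^sup>\<bottom>))\<^sup>\<bottom>\<^sup>\<bottom> = UNIV"
      using orthogonal_comp_anti_mono orthogonal_comp_null by blast
    then show ?thesis
      by (simp add: orthogonal_comp_self[OF \<open>subspace (fst ` (G\<^sup>\<bottom>))\<close>])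
  qed
  then obtain b where b: "(H1 *v v, b) \<in> G\<^sup>\<bottom>"
    by auto
  \<comment> \<open>Orthogonality of \<open>(H1 *v v, b)\<close> to \<open>(x, y)\<close> reads
    \<open>(H1 *v v) \<bullet> x + b \<bullet> y = 0\<close>, whence the sign.\<close>
  obtain w where w: "H2 *v w = - b"
    using surj_qinvertible[OF inv2] by (metis surjD)
  have "(H1 *v v) \<bullet> x = (H2 *v w) \<bullet> y" if "(x, y) \<in> G" for x y
    using b that by (fastforce simp: w orthogonal_comp_def orthogonal_def inner_commute)
  then have "qform H1 v x = qform H2 w y" if "(x, y) \<in> G" for x y
    using that scale by (intro qform_eqI) blast
  then show ?thesis by blast
qed

section \<open>Enlarging a partial isometry by one pair\<close>

text \<open>The quaternionic line through \<open>(v, w)\<close> is added to the graph. The first two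
  assumptions keep it single-valued and injective; the last two give all new values of the
  form.\<close>

lemma extend_by_vector:
  assumes v: "v \<notin> Domain G" and w: "w \<notin> Range G"
    and cross: "\<And>x y. (x, y) \<in> G \<Longrightarrow> qform H1 v x = qform H2 w y"
    and self: "qform H1 v v = qform H2 w w"
  shows "\<exists>G'. partial_isometry H1 H2 G' \<and> G \<subset> G'"
proof (intro exI conjI)
  define G' where "G' = {(x + v *r c, y + w *r c) |x y c. (x, y) \<in> G}"
  have I: "(x + v *r c, y + w *r c) \<in> G'" if "(x, y) \<in> G" for x y c
    using that by (auto simp: G'_def)
  have E: "\<exists>x y c. p = x + v *r c \<and> q = y + w *r c \<and> (x, y) \<in> G" if "(p, q) \<in> G'" for p q
    using that by (auto simp: G'_def)
  \<comment> \<open>A nonzero coefficient is invertible and would put \<open>v\<close> into the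
    domain or \<open>w\<close> into the range.\<close>
  have c0: "c = 0" if "(x, y) \<in> G" "x + v *r c = 0 \<or> y + w *r c = 0" for x y c
  proof (rule ccontr)
    assume "c \<noteq> 0"
    have "(x *r (- 1), y *r (- 1)) \<in> G"
      using that by (intro scale)
    then have xy: "- x \<in> Domain G" "- y \<in> Range G"
      by (auto simp: rscale_simps)
    have "v *r c = - x \<or> w *r c = - y"
      using that(2) by (metis eq_neg_iff_add_eq_0 add.commute)
    then show False
      using xy v w rscale_in_rsubspaceD[OF rsubspace_Domain _ \<open>c \<noteq> 0\<close>]
        rscale_in_rsubspaceD[OF rsubspace_Range _ \<open>c \<noteq> 0\<close>] by metis
  qed
  have cross': "qform H1 x v = qform H2 y w" if "(x, y) \<in> G" for x y
    using cross[OF that] qform_hermitian[OF herm1] qform_hermitian[OF herm2] by metis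
  show "partial_isometry H1 H2 G'"
  proof unfold_locales
    show "(0, 0) \<in> G'"
      using I[OF zero, of 0] by (simp add: rscale_simps)
  next
    fix p q p' q' assume "(p, q) \<in> G'" "(p', q') \<in> G'"
    then obtain x y c x' y' c' where *: "p = x + v *r c" "q = y + w *r c" "(x, y) \<in> G"
      "p' = x' + v *r c'" "q' = y' + w *r c'" "(x', y') \<in> G"
      using E by meson
    have "p + p' = (x + x') + v *r (c + c')" "q + q' = (y + y') + w *r (c + c')"
      by (simp_all add: * rscale_simps)
    then show "(p + p', q + q') \<in> G'"
      using I[OF add[OF *(3,6)]] by simp
    show "qform H1 p p' = qform H2 q q'"
      by (simp add: * qform_add qform_rscale form[OF *(3,6)] cross[OF *(6)] cross'[OF *(3)] self)
  next
    fix p q c assume "(p, q) \<in> G'"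
    then obtain x y d where *: "p = x + v *r d" "q = y + w *r d" "(x, y) \<in> G"
      using E by meson
    show "(p *r c, q *r c) \<in> G'"
      using I[OF scale[OF *(3)], of c "d * c"] by (simp add: * rscale_simps)
  next
    fix q assume "(0, q) \<in> G'"
    then obtain x y c where *: "0 = x + v *r c" "q = y + w *r c" "(x, y) \<in> G"
      using E by meson
    with c0[of x y c] show "q = 0"
      by (auto simp: rscale_simps intro: left0)
  next
    fix p assume "(p, 0) \<in> G'"
    then obtain x y c where *: "p = x + v *r c" "0 = y + w *r c" "(x, y) \<in> G"
      using E by meson
    with c0[of x y c] show "p = 0"
      by (auto simp: rscale_simps intro: right0)
  qed (rule herm1 herm2 inv1 inv2)+
  have "G \<subseteq> G'"
    using I[of _ _ 0] by (auto simp: rscale_simps)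
  moreover have "(v, w) \<in> G'"
    using I[OF zero, of 1] by (simp add: rscale_simps)
  ultimately show "G \<subset> G'"
    using v by blast
qed

text \<open>If \<open>r\<close> lies in the radical of the domain, adding a multiple of its image \<open>s\<close> to \<open>w\<close> does not
  affect \<open>[w, _]\<^sub>2\<close> on the range and adjusts \<open>[w, w]\<^sub>2\<close> to any prescribed value.\<close>

lemma extend_radical:
  assumes r: "r \<in> Domain G" "r \<in> T1.perp (Domain G)" "r \<noteq> 0"
  shows "\<exists>G'. partial_isometry H1 H2 G' \<and> G \<subset> G'"
proof -
  obtain s where s: "(r, s) \<in> G"
    using r by blast
  have r_perp: "qform H1 r x = 0" "qform H1 x r = 0" if "x \<in> Domain G" for x
    using r(2) that form_swap1 by (auto simp: perp_Domain_iff)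
  have s_perp: "qform H2 s y = 0" "qform H2 y s = 0" if "(x, y) \<in> G" for x y
    using form[OF s that] form[OF that s] r_perp[of x] that by auto
  \<comment> \<open>With this choice the real part of \<open>qform H1 r v\<close> is
    \<open>v \<bullet> v > 0\<close>, so \<open>v\<close> is not orthogonal to
    \<open>r\<close>.\<close>
  define v where "v = H1 *v r"
  have "v \<noteq> 0"
    using inj_qinvertible[OF inv1] r(3) T1.zero unfolding v_def by (metis injD)
  then have "qRe (qform H1 r v) \<noteq> 0"
    by (simp add: qRe_qform v_def[symmetric])
  then have rv: "qform H1 r v \<noteq> 0" and a0: "qform H1 v r \<noteq> 0"
    using form_swap1 by (metis zero_quat.simps(1))+
  obtain w where w: "\<And>x y. (x, y) \<in> G \<Longrightarrow> qform H1 v x = qform H2 w y"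
    using transport_functional[of v] by blast
  define a where "a = qform H2 w s"
  have "a \<noteq> 0"
    using a0 w[OF s] by (simp add: a_def)
  \<comment> \<open>Since \<open>qform H2 s s = 0\<close>, adding
    \<open>s *r (t *\<^sub>R a)\<close> changes the value at \<open>w\<close> by the cross term
    \<open>2 * t * (a \<bullet> a)\<close> only; \<open>t\<close> makes up the difference.\<close>
  define t where "t = ((H1 *v v) \<bullet> v - (H2 *v w) \<bullet> w) / (2 * (a \<bullet> a))"
  define w' where "w' = w + s *r (t *\<^sub>R a)"
  have w'_cross: "qform H2 w' y = qform H2 w y" if "(x, y) \<in> G" for x y
    using s_perp[OF that] by (simp add: w'_def qform_add qform_rscale)
  have "(H2 *v w) \<bullet> (s *r (t *\<^sub>R a)) = t * (a \<bullet> a)"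
    by (simp only: qRe_qform[symmetric] qform_rscale a_def[symmetric] inner_quat_def[symmetric]
        inner_scaleR_right)
  moreover have "(H2 *v (s *r (t *\<^sub>R a))) \<bullet> (s *r (t *\<^sub>R a)) = 0"
    using s_perp[OF s] by (simp add: qRe_qform[symmetric] qform_rscale)
  ultimately have "(H2 *v w') \<bullet> w' = (H2 *v w) \<bullet> w + 2 * (t * (a \<bullet> a))"
    by (simp add: w'_def T2.form_add)
  also have "\<dots> = (H1 *v v) \<bullet> v"
    using \<open>a \<noteq> 0\<close> by (simp add: t_def field_simps)
  \<comment> \<open>Hermitian forms are real on the diagonal, so equality of real parts
    suffices.\<close>
  finally have self: "qform H1 v v = qform H2 w' w'"
    by (simp add: qform_self herm1 herm2)
  show ?thesis
  proof (rule extend_by_vector)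
    show "v \<notin> Domain G"
      using rv r_perp by blast
    show "w' \<notin> Range G"
    proof
      assume "w' \<in> Range G"
      then have "qform H2 w' s = 0"
        using s_perp by blast
      with w'_cross[OF s] \<open>a \<noteq> 0\<close> show False
        by (simp add: a_def)
    qed
    show "qform H1 v x = qform H2 w' y" if "(x, y) \<in> G" for x y
      using w[OF that] w'_cross[OF that] by simp
  qed (rule self)
qed

lemma perp_Range_iff: "y \<in> T2.perp (Range G) \<longleftrightarrow> (\<forall>z\<in>Range G. qform H2 y z = 0)"
  using partial_isometry.perp_Domain_iff[OF partial_isometry_converse] by simp

text \<open>Rescaling \<open>w\<close> by a real factor matches the two diagonal values, and the
  cross terms vanish on both sides by orthogonality.\<close>

lemma extend_same_sign:
  assumes v: "v \<in> T1.perp (Domain G)" and w: "w \<in> T2.perp (Range G)"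
    and sgn: "((H1 *v v) \<bullet> v) * ((H2 *v w) \<bullet> w) > 0"
  shows "\<exists>G'. partial_isometry H1 H2 G' \<and> G \<subset> G'"
proof -
  define t where "t = sqrt (((H1 *v v) \<bullet> v) / ((H2 *v w) \<bullet> w))"
  have nz: "(H1 *v v) \<bullet> v \<noteq> 0" "(H2 *v w) \<bullet> w \<noteq> 0"
    using sgn by auto
  have "((H1 *v v) \<bullet> v) / ((H2 *v w) \<bullet> w) \<ge> 0"
    using sgn by (auto simp: zero_less_mult_iff zero_le_divide_iff)
  then have "t\<^sup>2 = ((H1 *v v) \<bullet> v) / ((H2 *v w) \<bullet> w)"
    by (simp add: t_def)
  then have "(H2 *v (t *\<^sub>R w)) \<bullet> (t *\<^sub>R w) = (H1 *v v) \<bullet> v"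
    using nz by (simp only: T2.form_scale) simp
  then have self: "qform H1 v v = qform H2 (t *\<^sub>R w) (t *\<^sub>R w)"
    by (simp add: qform_self herm1 herm2)
  have tw: "t *\<^sub>R w \<in> T2.perp (Range G)"
    using w T2.subspace_perp by (simp add: subspace_scale)
  show ?thesis
  proof (rule extend_by_vector)
    show "v \<notin> Domain G"
      using v nz by (auto simp: T1.perp_def)
    show "t *\<^sub>R w \<notin> Range G"
    proof
      assume "t *\<^sub>R w \<in> Range G"
      then have "qform H1 v v = 0"
        using tw self by (simp add: perp_Range_iff)
      then show False
        using nz(1) qRe_qform[of H1 v v] by simp
    qed
    show "qform H1 v x = qform H2 (t *\<^sub>R w) y" if "(x, y) \<in> G" for x y
    proof -
      have "x \<in> Domain G" "y \<in> Range G" using that by auto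
      then show ?thesis
        using v tw by (simp add: perp_Domain_iff perp_Range_iff)
    qed
  qed (rule self)
qed

text \<open>Projecting a maximal positive definite subspace for \<open>H1\<close> along the complement of the domain
  keeps it positive definite; its image can be enlarged by \<open>w\<close>.\<close>

lemma pos_space_dim_less:
  assumes nondeg: "Domain G \<inter> T1.perp (Domain G) = {0}"
    and nonpos: "\<And>u. u \<in> T1.perp (Domain G) \<Longrightarrow> (H1 *v u) \<bullet> u \<le> 0"
    and w: "w \<in> T2.perp (Range G)" "(H2 *v w) \<bullet> w > 0"
  shows "dim T1.pos_space < dim T2.pos_space"
proof -
  \<comment> \<open>The graph of projecting onto the domain along its complement and then applying
    the isometry; nondegeneracy makes it a total function \<open>F\<close>.\<close>
  define K where "K = {(x + u, y) |x y u. (x, y) \<in> G \<and> u \<in> T1.perp (Domain G)}"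
  have KI: "(x + u, y) \<in> K" if "(x, y) \<in> G" "u \<in> T1.perp (Domain G)" for x y u
    using that by (auto simp: K_def)
  have KE: "\<exists>x u. p = x + u \<and> (x, q) \<in> G \<and> u \<in> T1.perp (Domain G)" if "(p, q) \<in> K" for p q
    using that by (auto simp: K_def)
  have "subspace K"
    unfolding subspace_def
  proof (intro conjI ballI allI)
    show "0 \<in> K"
      using KI[OF zero subspace_0[OF T1.subspace_perp]] by (simp add: zero_prod_def)
  next
    fix g g' assume "g \<in> K" "g' \<in> K"
    then obtain x y u x' y' u' where *: "g = (x + u, y)" "(x, y) \<in> G" "u \<in> T1.perp (Domain G)"
      "g' = (x' + u', y')" "(x', y') \<in> G" "u' \<in> T1.perp (Domain G)"
      unfolding K_def by blast
    have "((x + x') + (u + u'), y + y') \<in> K"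
      using * by (intro KI add subspace_add[OF T1.subspace_perp])
    then show "g + g' \<in> K"
      by (simp add: * algebra_simps)
  next
    fix g and r :: real assume "g \<in> K"
    then obtain x y u where *: "g = (x + u, y)" "(x, y) \<in> G" "u \<in> T1.perp (Domain G)"
      unfolding K_def by blast
    have "(r *\<^sub>R x, r *\<^sub>R y) \<in> G"
      using subspace_scale[OF subspace_graph *(2), of r] by simp
    then have "(r *\<^sub>R x + r *\<^sub>R u, r *\<^sub>R y) \<in> K"
      using * by (intro KI subspace_scale[OF T1.subspace_perp])
    then show "r *\<^sub>R g \<in> K"
      by (simp add: * scaleR_add_right)
  qed
  moreover have "Domain K = UNIV"
  proof -
    have "p \<in> Domain K" for p
    proof -
      obtain x u where "x \<in> Domain G" "u \<in> T1.perp (Domain G)" "p = x + u"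
        using T1.perp_decomp[OF inj_qinvertible[OF inv1] rsubspace_imp_subspace[OF rsubspace_Domain] nondeg]
        by blast
      then show ?thesis using KI by blast
    qed
    then show ?thesis by blast
  qed
  moreover have "y = 0" if y: "(0, y) \<in> K" for y
  proof -
    obtain x u where *: "0 = x + u" "(x, y) \<in> G" "u \<in> T1.perp (Domain G)"
      using KE[OF y] by blast
    then have "x = - u"
      by (metis eq_neg_iff_add_eq_0)
    then have "x \<in> Domain G \<inter> T1.perp (Domain G)"
      using * subspace_neg[OF T1.subspace_perp] by blast
    then have "x = 0"
      using nondeg by simp
    with *(2) left0 show ?thesis by simp
  qed
  ultimately obtain F where F: "linear F" "\<And>p. (p, F p) \<in> K"
    using linear_of_graph[of K] by auto
  have F_Range: "F p \<in> Range G" for p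
    using KE[OF F(2)[of p]] by blast
  then have wF: "(H2 *v w) \<bullet> F p = 0" for p
    using w(1) by (simp add: T2.perp_def)
  \<comment> \<open>The projection discards \<open>u\<close>, where the form is nonpositive, so the
    value of the form cannot decrease.\<close>
  have F_form: "(H2 *v F p) \<bullet> F p \<ge> (H1 *v p) \<bullet> p" for p
  proof -
    obtain x u where *: "p = x + u" "(x, F p) \<in> G" "u \<in> T1.perp (Domain G)"
      using KE[OF F(2)[of p]] by blast
    have "(H1 *v x) \<bullet> u = 0"
      using * T1.form_commute[of x u] by (auto simp: T1.perp_def)
    then have "(H1 *v p) \<bullet> p = (H1 *v x) \<bullet> x + (H1 *v u) \<bullet> u"
      using *(1) by (simp add: T1.form_add)
    moreover have "(H1 *v x) \<bullet> x = (H2 *v F p) \<bullet> F p"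
      using form[OF *(2,2)] by (simp add: qRe_qform[symmetric])
    ultimately show ?thesis
      using nonpos[OF *(3)] by simp
  qed
  let ?P = "T1.pos_space"
  let ?Q = "span (insert w (F ` ?P))"
  have FP: "span (F ` ?P) = F ` ?P"
    by (intro span_eq_iff[THEN iffD2] linear_subspace_image F(1) T1.subspace_pos_space)
  have P_pos: "(H1 *v p) \<bullet> p > 0" if "p \<in> ?P" "p \<noteq> 0" for p
    using that T1.pos_def_pos_space by (simp add: T1.pos_def_on_def)
  have "inj_on F ?P"
  proof (rule linear_injective_on_subspace_0[OF F(1) T1.subspace_pos_space, THEN iffD2], intro ballI impI)
    fix p assume "p \<in> ?P" "F p = 0"
    then show "p = 0"
      using F_form[of p] P_pos[of p] by fastforce
  qed
  then have "dim (F ` ?P) = dim ?P"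
    by (intro dim_image_eq F(1)) (simp add: T1.subspace_pos_space span_eq_iff[THEN iffD2])
  \<comment> \<open>The image of \<open>F\<close> is orthogonal to \<open>w\<close>, while
    \<open>w\<close> is not orthogonal to itself.\<close>
  moreover have "w \<notin> F ` ?P"
    using wF w(2) by force
  ultimately have "dim ?Q = dim ?P + 1"
    by (simp add: dim_insert FP)
  moreover have "dim ?Q \<le> dim T2.pos_space"
  proof (rule T2.pos_def_dim_le)
    show "T2.pos_def_on ?Q"
      unfolding T2.pos_def_on_def
    proof (intro ballI impI)
      fix q assume "q \<in> ?Q" "q \<noteq> 0"
      then obtain k p where p: "p \<in> ?P" "q - k *\<^sub>R w = F p"
        unfolding span_breakdown_eq FP by blast
      then have q: "q = k *\<^sub>R w + F p"
        by (simp add: algebra_simps)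
      have eq: "(H2 *v q) \<bullet> q = k\<^sup>2 * ((H2 *v w) \<bullet> w) + (H2 *v F p) \<bullet> F p"
        using wF[of p] by (simp add: q T2.form_add T2.scale power2_eq_square)
      show "(H2 *v q) \<bullet> q > 0"
      proof (cases "p = 0")
        case True
        then have "k \<noteq> 0" "F p = 0"
          using \<open>q \<noteq> 0\<close> q linear_0[OF F(1)] by auto
        then show ?thesis
          using eq w(2) by simp
      next
        case False
        have "k\<^sup>2 * ((H2 *v w) \<bullet> w) \<ge> 0"
          using w(2) by simp
        then show ?thesis
          using eq F_form[of p] P_pos[OF p(1) False] by linarith
      qed
    qed
  qed simp
  ultimately show ?thesis by simp
qed

text \<open>A radical vector of the range is the image of a radical vector of the domain.\<close>

lemma nondegenerate_Range:
  assumes "Domain G \<inter> T1.perp (Domain G) = {0}"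
  shows "Range G \<inter> T2.perp (Range G) = {0}"
proof -
  have "y = 0" if y: "(x, y) \<in> G" "y \<in> T2.perp (Range G)" for x y
  proof -
    have "qform H1 x x' = 0" if "(x', y') \<in> G" for x' y'
      using form[OF y(1) that] y(2) that by (auto simp: perp_Range_iff)
    then have "x \<in> T1.perp (Domain G)"
      by (auto simp: perp_Domain_iff)
    with y(1) have "x \<in> Domain G \<inter> T1.perp (Domain G)"
      by blast
    then have "x = 0"
      using assms by simp
    with y(1) left0 show ?thesis by simp
  qed
  moreover have "0 \<in> Range G" "0 \<in> T2.perp (Range G)"
    using zero subspace_0[OF T2.subspace_perp] by auto
  ultimately show ?thesis
    by auto
qed

text \<open>Without an extension the domain is nondegenerate and anisotropic vectors of the two
  complements have opposite signs. A positive vector on one side makes the other complement negative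
  semidefinite, and \<open>pos_space_dim_less\<close> contradicts equal inertia.\<close>

lemma extend:
  assumes inertia: "pos_inertia H1 = pos_inertia H2" and "Domain G \<noteq> UNIV"
  shows "\<exists>G'. partial_isometry H1 H2 G' \<and> G \<subset> G'"
proof (rule ccontr)
  assume no_ext: "\<not> ?thesis"
  interpret conv: partial_isometry H2 H1 "G\<inverse>"
    by (rule partial_isometry_converse)
  have nd1: "Domain G \<inter> T1.perp (Domain G) = {0}"
    using extend_radical no_ext zero subspace_0[OF T1.subspace_perp] by blast
  note nd2 = nondegenerate_Range[OF nd1]
  have "Range G \<noteq> UNIV"
  proof
    assume "Range G = UNIV"
    then have "dim (Domain G) = DIM(quat ^ 'n)"
      using dim_Domain dim_Range by simp
    with \<open>Domain G \<noteq> UNIV\<close> show False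
      using rsubspace_imp_subspace[OF rsubspace_Domain]
      by (simp only: dim_eq_full span_eq_iff[THEN iffD2])
  qed
  then obtain w where w: "w \<in> T2.perp (Range G)" "(H2 *v w) \<bullet> w \<noteq> 0"
    by (rule T2.perp_anisotropic_vector[OF inj_qinvertible[OF inv2]
          rsubspace_imp_subspace[OF rsubspace_Range] nd2])
  obtain v where v: "v \<in> T1.perp (Domain G)" "(H1 *v v) \<bullet> v \<noteq> 0"
    by (rule T1.perp_anisotropic_vector[OF inj_qinvertible[OF inv1]
          rsubspace_imp_subspace[OF rsubspace_Domain] nd1 \<open>Domain G \<noteq> UNIV\<close>])
  have dims: "dim T1.pos_space = dim T2.pos_space"
    using inertia pos_inertia_dim[OF herm1] pos_inertia_dim[OF herm2] by simp
  have opp: "\<not> ((H1 *v v) \<bullet> v) * ((H2 *v w) \<bullet> w) > 0"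
    if "v \<in> T1.perp (Domain G)" "w \<in> T2.perp (Range G)" for v w
    using extend_same_sign[OF that] no_ext by blast
  show False
  proof (cases "(H1 *v v) \<bullet> v > 0")
    case True
    \<comment> \<open>The positive vector lies on the domain side, so the strict inequality is
      applied to the converse isometry.\<close>
    then have "(H2 *v u) \<bullet> u \<le> 0" if "u \<in> T2.perp (Range G)" for u
      using opp[OF v(1) that] by (simp add: zero_less_mult_iff not_less)
    with conv.pos_space_dim_less[of v] nd2 v(1) True dims show False by simp
  next
    case False
    with opp[OF v(1) w(1)] v(2) w(2) have w_pos: "(H2 *v w) \<bullet> w > 0"
      by (auto simp: zero_less_mult_iff)
    then have "(H1 *v u) \<bullet> u \<le> 0" if "u \<in> T1.perp (Domain G)" for u
      using opp[OF that w(1)] by (simp add: zero_less_mult_iff not_less)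
    with pos_space_dim_less[of w] nd1 w(1) w_pos dims show False by simp
  qed
qed

end

section \<open>Maximal extension and the resulting global isometry\<close>

lemma partial_isometry_extends_to_total:
  assumes "partial_isometry H1 H2 G" "pos_inertia H1 = pos_inertia H2"
  obtains G' where "partial_isometry H1 H2 G'" "G \<subseteq> G'" "Domain G' = UNIV"
proof -
  let ?P = "\<lambda>G'. partial_isometry H1 H2 G' \<and> G \<subseteq> G'"
  \<comment> \<open>Graph dimensions are at most that of the product space, so a largest one exists;
    the \<open>+ 1\<close> makes the bound strict.\<close>
  obtain G' where G': "?P G'" and max: "\<And>G''. ?P G'' \<Longrightarrow> dim G'' \<le> dim G'"
    using ex_has_greatest_nat[of ?P G dim "DIM((quat ^ 'n) \<times> (quat ^ 'n)) + 1"] assms(1)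
      dim_subset_UNIV by (metis less_Suc_eq_le Suc_eq_plus1 subset_refl)
  have "Domain G' = UNIV"
  proof (rule ccontr)
    assume "Domain G' \<noteq> UNIV"
    then obtain G'' where G'': "partial_isometry H1 H2 G''" "G' \<subset> G''"
      using partial_isometry.extend[of H1 H2 G'] G' assms(2) by blast
    have "span G' = G'" "span G'' = G''"
      using G' G'' partial_isometry.subspace_graph span_eq_iff by blast+
    with G''(2) have "dim G' < dim G''"
      by (intro dim_psubset) (simp only:)
    with max[of G''] G' G'' show False by auto
  qed
  with G' that show thesis by blast
qed

theorem theorem5p1:
  fixes H1 H2 :: "quat ^ 'n ^ 'n"
    and V1 V2 :: "(quat ^ 'n) set"
    and U0 :: "quat ^ 'n \<Rightarrow> quat ^ 'n"
  assumes "qhermitian H1" and "qinvertible H1"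
    and "qhermitian H2" and "qinvertible H2"
    and "pos_inertia H1 = pos_inertia H2"
    and "rsubspace V1" and "rsubspace V2"
    and "U0 ` V1 \<subseteq> V2" and "rlinear_on V1 U0" and "inj_on U0 V1"
    and "\<forall>x\<in>V1. \<forall>y\<in>V1. qform H2 (U0 x) (U0 y) = qform H1 x y"
  shows "\<exists>U. rlinear_on UNIV U
           \<and> (\<forall>x y. qform H2 (U x) (U y) = qform H1 x y)
           \<and> (\<forall>x\<in>V1. U x = U0 x)"
proof -
  define G0 where "G0 = {(x, U0 x) |x. x \<in> V1}"
  have V1: "0 \<in> V1" "\<And>x y. x \<in> V1 \<Longrightarrow> y \<in> V1 \<Longrightarrow> x + y \<in> V1" "\<And>x c. x \<in> V1 \<Longrightarrow> x *r c \<in> V1"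
    using assms(6) by (auto simp: rsubspace_def)
  have U0: "\<And>x y. x \<in> V1 \<Longrightarrow> y \<in> V1 \<Longrightarrow> U0 (x + y) = U0 x + U0 y"
    "\<And>x c. x \<in> V1 \<Longrightarrow> U0 (x *r c) = U0 x *r c"
    using assms(9) by (auto simp: rlinear_on_def)
  have U0_0: "U0 0 = 0"
    using U0(2)[OF V1(1), of 0] by (simp add: rscale_simps)
  have "partial_isometry H1 H2 G0"
  proof (unfold_locales)
    \<comment> \<open>Injectivity of \<open>U0\<close> enters here: the only point over the value 0
      is 0.\<close>
    show "x = 0" if "(x, 0) \<in> G0" for x
      using that inj_onD[OF assms(10), of x 0] V1(1) U0_0 by (auto simp: G0_def)
  qed (use assms(1-4,11) in \<open>auto simp: G0_def V1 U0 U0_0\<close>)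
  then obtain G where "partial_isometry H1 H2 G" "G0 \<subseteq> G" "Domain G = UNIV"
    using assms(5) by (rule partial_isometry_extends_to_total)
  then interpret partial_isometry H1 H2 G by simp
  obtain U where U: "linear U" "\<And>x. (x, U x) \<in> G"
    using linear_of_graph[OF subspace_graph \<open>Domain G = UNIV\<close> left0] by blast
  have U_eq: "U x = y" if "(x, y) \<in> G" for x y
    using left0[of "U x - y"] subspace_diff[OF subspace_graph U(2)[of x] that] by simp
  show ?thesis
  proof (intro exI conjI ballI allI)
    \<comment> \<open>\<open>linear U\<close> gives additivity; quaternionic homogeneity comes from
      closure of \<open>G\<close> under right scalars and uniqueness of values.\<close>
    show "rlinear_on UNIV U"
      unfolding rlinear_on_def using linear_add[OF U(1)] U_eq[OF scale[OF U(2)]] by blast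
    show "qform H2 (U x) (U y) = qform H1 x y" for x y
      using form[OF U(2) U(2)] by simp
    show "U x = U0 x" if "x \<in> V1" for x
      using that \<open>G0 \<subseteq> G\<close> by (intro U_eq) (auto simp: G0_def)
  qed
qed

end
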